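(* Let $X$ be a set, $E$ a set of parameters, and let $\boldsymbol{\Sigma}=\{\Sigma_e : e\in E\}$ be a family of crisp topologies on $X$ indexed by $E$. If $(X,\Sigma_e)$ is a $T_0$-space for some $e\in E$, then $\mathcal{T}(\boldsymbol{\Sigma})$ is a soft $T_0$-space.
   Context: A "crisp" topology is an ordinary topology. A soft set over $X$ (with parameter set $E$) is $(F,E)=\{(e,F(e)) : e\in E\}$ where $F:E\to\mathcal{P}(X)$ is a map; $S_E(X)$ is the family of all soft sets. For $x\in X$, $x\in(F,E)$ means $x\in F(e)$ for every $e\in E$; $x\notin(F,E)$ means $x\notin F(e)$ for some $e\in E$. Unions and intersections of soft sets are taken parameterwise. A soft topology on $X$ is a collection of soft sets containing the null soft set ($F(e)=\emptyset$ for all $e$) and the absolute soft set ($F(e)=X$ for all $e$), closed under pairwise intersections and arbitrary unions; its members are called soft open sets. The soft topology generated by $\boldsymbol{\Sigma}=\{\Sigma_e : e\in E\}$ is $\mathcal{T}(\boldsymbol{\Sigma})=\{(F,E)\in S_E(X) : F(e)\in\Sigma_e \text{ for all } e\in E\}$. A soft topology on $X$ is soft $T_0$ if for all $x,y\in X$ with $x\neq y$ there exist soft open sets $(U,E),(V,E)$ such that [$x\in(U,E)$ and $y\notin(U,E)$] or [$x\notin(V,E)$ and $y\in(V,E)$]. *)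

theory Defs
  imports "HOL-Analysis.Abstract_Topological_Spaces" "HOL-Library.FuncSet"
begin

text \<open>
  A soft set over \<open>X\<close> with parameter set \<open>E\<close> is a map from \<open>E\<close> to the powerset of \<open>X\<close>.
  Maps are taken to be extensional (\<open>undefined\<close> outside \<open>E\<close>), so that HOL equality of
  functions is equality of the graphs \<open>{(e, F e) | e \<in> E}\<close>.
\<close>

type_synonym ('e, 'a) soft_set = "'e \<Rightarrow> 'a set"

definition soft_sets :: "'a set \<Rightarrow> 'e set \<Rightarrow> ('e, 'a) soft_set set" where
  "soft_sets X E = (E \<rightarrow>\<^sub>E Pow X)"

text \<open>Non-membership is the negation: \<open>x \<notin> F e\<close> for some \<open>e \<in> E\<close>.\<close>

definition soft_member :: "'e set \<Rightarrow> 'a \<Rightarrow> ('e, 'a) soft_set \<Rightarrow> bool" where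
  "soft_member E x F \<longleftrightarrow> (\<forall>e\<in>E. x \<in> F e)"

definition soft_null :: "'e set \<Rightarrow> ('e, 'a) soft_set" where
  "soft_null E = (\<lambda>e\<in>E. {})"

definition soft_absolute :: "'a set \<Rightarrow> 'e set \<Rightarrow> ('e, 'a) soft_set" where
  "soft_absolute X E = (\<lambda>e\<in>E. X)"

definition soft_Int :: "'e set \<Rightarrow> ('e, 'a) soft_set \<Rightarrow> ('e, 'a) soft_set \<Rightarrow> ('e, 'a) soft_set" where
  "soft_Int E F G = (\<lambda>e\<in>E. F e \<inter> G e)"

definition soft_Union :: "'e set \<Rightarrow> ('e, 'a) soft_set set \<Rightarrow> ('e, 'a) soft_set" where
  "soft_Union E \<F> = (\<lambda>e\<in>E. \<Union>F\<in>\<F>. F e)"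

definition soft_topology :: "'a set \<Rightarrow> 'e set \<Rightarrow> ('e, 'a) soft_set set \<Rightarrow> bool" where
  "soft_topology X E \<T> \<longleftrightarrow>
     \<T> \<subseteq> soft_sets X E \<and>
     soft_null E \<in> \<T> \<and>
     soft_absolute X E \<in> \<T> \<and>
     (\<forall>F\<in>\<T>. \<forall>G\<in>\<T>. soft_Int E F G \<in> \<T>) \<and>
     (\<forall>\<F>\<subseteq>\<T>. soft_Union E \<F> \<in> \<T>)"

definition soft_T0_space :: "'a set \<Rightarrow> 'e set \<Rightarrow> ('e, 'a) soft_set set \<Rightarrow> bool" where
  "soft_T0_space X E \<T> \<longleftrightarrow>
     soft_topology X E \<T> \<and>
     (\<forall>x\<in>X. \<forall>y\<in>X. x \<noteq> y \<longrightarrow>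
        (\<exists>U\<in>\<T>. \<exists>V\<in>\<T>.
           (soft_member E x U \<and> \<not> soft_member E y U) \<or>
           (\<not> soft_member E x V \<and> soft_member E y V)))"

definition generated_soft_topology ::
    "'a set \<Rightarrow> 'e set \<Rightarrow> ('e \<Rightarrow> 'a topology) \<Rightarrow> ('e, 'a) soft_set set" where
  "generated_soft_topology X E \<Sigma> = {F \<in> soft_sets X E. \<forall>e\<in>E. openin (\<Sigma> e) (F e)}"

end

theory Submission imports Defs begin

text \<open>Openness in the generated family is tested one parameter at a time, with no
  compatibility between parameters. So a set \<open>W\<close> that is open at the T0 parameter
  \<open>d\<close> and separates \<open>x\<close> from \<open>y\<close> extends to a soft open set
  by taking all of \<open>X\<close> elsewhere, and this soft set still separates them. The soft
  topology axioms in \<open>soft_topology_generated\<close> likewise reduce to those of each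
  \<open>\<Sigma> e\<close>.\<close>

lemma soft_topology_generated:
  assumes top: "\<And>e. e \<in> E \<Longrightarrow> topspace (\<Sigma> e) = X"
  shows "soft_topology X E (generated_soft_topology X E \<Sigma>)"
proof -
  let ?T = "generated_soft_topology X E \<Sigma>"
  \<comment> \<open>The null and absolute soft sets, intersections and unions are all maps
    restricted to \<open>E\<close>, so this one rule covers the four closure conditions.\<close>
  have memI: "(\<lambda>e\<in>E. f e) \<in> ?T" if "\<And>e. e \<in> E \<Longrightarrow> openin (\<Sigma> e) (f e)" for f
    using that top openin_subset
    by (fastforce simp: generated_soft_topology_def soft_sets_def)
  have memD: "openin (\<Sigma> e) (F e)" if "F \<in> ?T" "e \<in> E" for F e
    using that by (simp add: generated_soft_topology_def)
  have "?T \<subseteq> soft_sets X E"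
    by (auto simp: generated_soft_topology_def)
  moreover have "soft_null E \<in> ?T"
    unfolding soft_null_def by (rule memI) simp
  moreover have "soft_absolute X E \<in> ?T"
    unfolding soft_absolute_def by (rule memI) (metis top openin_topspace)
  moreover have "soft_Int E F G \<in> ?T" if "F \<in> ?T" "G \<in> ?T" for F G
    unfolding soft_Int_def using that by (intro memI openin_Int memD)
  moreover have "soft_Union E \<F> \<in> ?T" if "\<F> \<subseteq> ?T" for \<F>
    unfolding soft_Union_def using that by (intro memI openin_Union) (auto intro: memD)
  ultimately show ?thesis
    by (simp add: soft_topology_def)
qed

theorem theorem5p2:
  fixes X :: "'a set" and E :: "'e set" and \<Sigma> :: "'e \<Rightarrow> 'a topology"
  assumes "\<forall>e\<in>E. topspace (\<Sigma> e) = X"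
    and "\<exists>e\<in>E. t0_space (\<Sigma> e)"
  shows "soft_T0_space X E (generated_soft_topology X E \<Sigma>)"
proof -
  let ?T = "generated_soft_topology X E \<Sigma>"
  obtain d where d: "d \<in> E" "t0_space (\<Sigma> d)"
    using assms(2) by blast
  have "\<exists>U\<in>?T. \<exists>V\<in>?T. (soft_member E x U \<and> \<not> soft_member E y U) \<or>
           (\<not> soft_member E x V \<and> soft_member E y V)"
    if xy: "x \<in> X" "y \<in> X" "x \<noteq> y" for x y
  proof -
    obtain W where W: "openin (\<Sigma> d) W" "x \<notin> W \<longleftrightarrow> y \<in> W"
      using d xy assms(1) unfolding t0_space_def by metis
    \<comment> \<open>Extending by \<open>X\<close> in the other parameters makes soft membership depend on \<open>d\<close> alone.\<close>
    define U where "U = (\<lambda>e\<in>E. if e = d then W else X)"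
    have "W \<subseteq> X"
      using W(1) d(1) assms(1) openin_subset by fastforce
    moreover have "openin (\<Sigma> e) X" if "e \<in> E" for e
      using that assms(1) openin_topspace by metis
    ultimately have "U \<in> ?T"
      using W(1) by (auto simp: U_def generated_soft_topology_def soft_sets_def)
    moreover have "soft_member E z U \<longleftrightarrow> z \<in> W" if "z \<in> X" for z
      using that d(1) by (auto simp: U_def soft_member_def)
    \<comment> \<open>\<open>U\<close> witnesses both existentials; which disjunct holds depends on
      which of \<open>x\<close> and \<open>y\<close> lies in \<open>W\<close>.\<close>
    ultimately show ?thesis
      using W(2) xy by metis
  qed
  then show ?thesis
    using assms(1) by (simp add: soft_T0_space_def soft_topology_generated)
qed

end
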